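(* Let $m\ge 1$ be an integer and $\mathbf{u}=(1,m+1,2m+1,\dots)$. For $n\ge 1$ define $$\gamma_n^{(m)}(q,t,u,v)=\sum_{\mathbf{p}\in\mathcal{PK}(n;\mathbf{u})} q^{\mathrm{luck}(\mathbf{p})}\,t^{\omega_1(\mathbf{p})}\,u^{f(\mathbf{p})}\,v^{g(\mathbf{p})},$$ put $\gamma_0^{(m)}=1$, and let $\Gamma_m(x;q,t,u,v)=\sum_{n\ge 0}\gamma_n^{(m)}(q,t,u,v)\,x^n$. Then $$\Gamma_m(x;q,t,u,v)=1+xqt(uv)^2\,\mathcal{B}_m(x)^{m-1}\,\mathcal{B}_m(vx;q)\,\mathcal{B}_m(uvx;t).$$
   Context: $\mathcal{PK}(n;\mathbf{u})$ for $\mathbf{u}=(1,m+1,2m+1,\dots)$ is the set of weakly increasing sequences of positive integers $\mathbf{p}=(p_1,\dots,p_n)$ with $p_i\le m(i-1)+1$ for all $i$ (for $n=0$ it contains only the empty sequence). Statistics: $\mathrm{luck}(\mathbf{p})=|\{i: p_i=mi-m+1\}|$ and $\omega_1(\mathbf{p})=|\{i:p_i=1\}|$. For $1\le\ell\le m$, the first fixed point of $\mathbf{p}$ of type $\ell$ is the smallest index $k>1$ (with $k\le n$) such that $m(k-2)+1+\ell\le p_k\le m(k-1)+1$; by convention it is $n+1$ if no such $k$ exists. In particular, the first fixed point of type $m$ is the smallest $k>1$ with $p_k=m(k-1)+1$. Let $f(\mathbf{p})$ and $g(\mathbf{p})$ denote the first fixed points of $\mathbf{p}$ of type $1$ and type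 $m$ respectively. Generating functions: $\mathcal{B}_m(x)=\sum_{n\ge0}\frac{1}{mn+1}\binom{mn+n}{n}x^n$ and $\mathcal{B}_m(x;q)=\sum_{n\ge 0}x^n\sum_{\mathbf{p}\in\mathcal{PK}(n;\mathbf{u})}q^{\mathrm{luck}(\mathbf{p})}$.
   Formalization: The printed product is false (already at x^2, for every m); the arguments x and vx of the first two series are interchanged, so the formula proved is 1 + xqt(uv)^2 B_m(vx)^{m-1} B_m(x;q) B_m(uvx;t). *)

theory Defs
  imports "HOL-Computational_Algebra.Formal_Power_Series"
begin

(* A sequence p = (p_1, ..., p_n) is a list, so p_i is  p ! (i - 1). *)

definition PK :: "nat \<Rightarrow> nat \<Rightarrow> nat list set" where
  "PK m n = {p. length p = n \<and> sorted p \<and>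
     (\<forall>i\<in>{1..n}. 1 \<le> p ! (i - 1) \<and> p ! (i - 1) \<le> m * (i - 1) + 1)}"

lemma finite_PK: "finite (PK m n)"
proof (rule finite_subset)
  show "PK m n \<subseteq> {p. set p \<subseteq> {..m * n + 1} \<and> length p = n}"
  proof
    fix p assume p: "p \<in> PK m n"
    have "p ! j \<le> m * n + 1" if j: "j < n" for j
    proof -
      have "\<forall>i\<in>{1..n}. p ! (i - 1) \<le> m * (i - 1) + 1"
        using p by (simp add: PK_def)
      from bspec[OF this, of "Suc j"] j have "p ! j \<le> m * j + 1" by simp
      moreover have "m * j \<le> m * n" using j by (intro mult_le_mono2) simp
      ultimately show ?thesis by linarith
    qed
    then show "p \<in> {p. set p \<subseteq> {..m * n + 1} \<and> length p = n}"
      using p by (auto simp: PK_def in_set_conv_nth)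
  qed
  show "finite {p. set p \<subseteq> {..m * n + 1} \<and> length p = n}"
    by (rule finite_lists_length_eq) simp
qed

definition luck :: "nat \<Rightarrow> nat list \<Rightarrow> nat" where
  "luck m p = card {i \<in> {1..length p}. p ! (i - 1) = m * i - m + 1}"

definition omega1 :: "nat list \<Rightarrow> nat" where
  "omega1 p = card {i \<in> {1..length p}. p ! (i - 1) = 1}"

definition fixed_points :: "nat \<Rightarrow> nat \<Rightarrow> nat list \<Rightarrow> nat set" where
  "fixed_points m l p = {k. 1 < k \<and> k \<le> length p \<and>
     m * (k - 2) + 1 + l \<le> p ! (k - 1) \<and> p ! (k - 1) \<le> m * (k - 1) + 1}"

definition first_fixed_point :: "nat \<Rightarrow> nat \<Rightarrow> nat list \<Rightarrow> nat" where
  "first_fixed_point m l p =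
     (if fixed_points m l p = {} then length p + 1 else Min (fixed_points m l p))"

(* The division is exact (fuss_catalan_eq), so the number makes sense in every ring. *)
definition fuss_catalan :: "nat \<Rightarrow> nat \<Rightarrow> nat" where
  "fuss_catalan m n = ((m * n + n) choose n) div (m * n + 1)"

lemma fuss_catalan_dvd: "m * n + 1 dvd ((m * n + n) choose n)"
proof (cases n)
  case 0
  then show ?thesis by simp
next
  case (Suc k)
  have "Suc k * ((m * n + n) choose Suc k) = (m * n + n - k) * ((m * n + n) choose k)"
    by (simp only: binomial_absorption binomial_absorb_comp)
  moreover have "m * n + n - k = m * n + 1" using Suc by simp
  ultimately have "m * n + 1 dvd n * ((m * n + n) choose n)"
    using Suc by (metis dvd_triv_left)
  moreover have "coprime (m * n + 1) n"
    by (metis coprime_mult_right_iff coprime_add_one_left)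
  ultimately show ?thesis by (simp add: coprime_dvd_mult_right_iff)
qed

lemma fuss_catalan_eq:
  "real (fuss_catalan m n) = 1 / real (m * n + 1) * real ((m * n + n) choose n)"
  unfolding fuss_catalan_def using fuss_catalan_dvd[of m n]
  by (simp add: real_of_nat_div del: of_nat_add of_nat_mult of_nat_Suc)

(* Every series below is a power series in fps_X. The parameters q, t, u, v range over an
   arbitrary commutative ring, which includes the case of indeterminates, i.e. the ring
   Z[q,t,u,v]. *)

definition Bm :: "nat \<Rightarrow> 'a::comm_ring_1 fps" where
  "Bm m = Abs_fps (\<lambda>n. of_nat (fuss_catalan m n))"

definition Bmq :: "nat \<Rightarrow> 'a \<Rightarrow> 'a::comm_ring_1 fps" where
  "Bmq m q = Abs_fps (\<lambda>n. \<Sum>p\<in>PK m n. q ^ luck m p)"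

(* The value at n = 0 is a convention: the empty sequence would contribute u * v. *)
definition gamma_coeff :: "nat \<Rightarrow> nat \<Rightarrow> 'a \<Rightarrow> 'a \<Rightarrow> 'a \<Rightarrow> 'a \<Rightarrow> 'a::comm_ring_1" where
  "gamma_coeff m n q t u v = (if n = 0 then 1 else
     (\<Sum>p\<in>PK m n. q ^ luck m p * t ^ omega1 p
        * u ^ first_fixed_point m 1 p * v ^ first_fixed_point m m p))"

(* For m >= 1 the coefficient of x^2 in Gamma_fps is  q t (u v)^2 ((m - 1) v + q + u v t).
   The printed product formula  1 + x q t (u v)^2 B_m(x)^(m-1) B_m(v x;q) B_m(u v x;t)  gives
   q t (u v)^2 ((m - 1) + v q + u v t)  instead and so fails for every m; the arguments x and v x
   of its first two factors have to be interchanged. *)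
definition Gamma_fps :: "nat \<Rightarrow> 'a \<Rightarrow> 'a \<Rightarrow> 'a \<Rightarrow> 'a \<Rightarrow> 'a::comm_ring_1 fps" where
  "Gamma_fps m q t u v = Abs_fps (\<lambda>n. gamma_coeff m n q t u v)"

end

theory Submission
  imports Defs
begin

text \<open>
  Record a sequence \<open>p\<close> by its deficits \<open>e\<^sub>i = m (i - 1) + 1 - p\<^sub>i\<close>. Weak monotonicity and the
  bounds on \<open>p\<close> turn into \<open>e\<^sub>1 = 0\<close> and \<open>0 \<le> e\<^sub>i\<^sub>+\<^sub>1 \<le> e\<^sub>i + m\<close>, so \<open>e\<close> is a walk on the natural
  numbers whose steps go up by at most \<open>m\<close> and down by any amount (\<open>bij_deficits\<close>). The statistics
  become visible: the lucky positions are the zeros of \<open>e\<close>; the ones of \<open>p\<close> are the entries of the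
  initial climb in which every step is the largest possible; the first fixed point of type
  \<open>l\<close> is the first position after the start where \<open>e\<close> is at most \<open>m - l\<close>.

  Cut the walk, after its initial zero, at the first entry below \<open>m\<close> (position \<open>f\<close>) and at the first
  further zero (position \<open>g\<close>). The piece before \<open>f\<close> lies at height at least \<open>m\<close>; lowered by
  \<open>m\<close> it is an arbitrary walk from 0, it advances both \<open>f\<close> and \<open>g\<close>, and it alone carries the
  remaining ones of \<open>p\<close>: it gives \<open>\<B>\<^sub>m(uvx;t)\<close>, as soon as ones and lucky positions
  are known to be equidistributed. The piece between \<open>f\<close> and \<open>g\<close> starts below \<open>m\<close> and stays
  positive, and it advances only \<open>g\<close>: it gives \<open>\<B>\<^sub>m(vx)\<^bsup>m-1\<^esup>\<close>. The piece from \<open>g\<close> on is an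
  arbitrary walk from 0 that carries the remaining lucky positions: it gives \<open>\<B>\<^sub>m(x;q)\<close>.

  The product is obtained without cutting lists. Let \<open>F(j)\<close> be the weighted generating function of
  all walks whose first entry is less than \<open>j\<close>. Splitting off a first entry that multiplies the weight
  by \<open>y\<close> gives \<open>F(j+1) = F(j) + y x F(j+m+1)\<close>. This recursion determines every \<open>F(j)\<close> from
  \<open>F(0)\<close> linearly (\<open>first_step_recursion_solution\<close>): \<open>F(j) = F(0) a(j)\<close>, where \<open>a(j)\<close> counts
  walks with weight \<open>y\<close> for each entry. Applied to \<open>a\<close> itself it gives \<open>a(j) = a(1)\<^bsup>j\<^esup>\<close>, and
  \<open>a(1) = \<B>\<^sub>m(yx)\<close> by the ballot numbers. Each cut point is a height at which \<open>y\<close> changes: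
  the solution on one side is the initial value for the next (\<open>zero_fps_Suc\<close>, \<open>low_fps\<close>,
  \<open>full_fps\<close>), and the initial values multiply.

  The equidistribution appears as follows. A walk from 0 weighted by its zeros satisfies
  \<open>Z = 1 + t y x a(m) Z\<close>, as a zero is followed, up to the next zero, by
  a positive walk with first entry at most \<open>m\<close>.
  The generating function of walks weighted by the length of their steepest initial climb is
  \<open>\<Sum>\<^sub>k (t y x)\<^bsup>k\<^esup> a(k m) = \<Sum>\<^sub>k (t y x a(m))\<^bsup>k\<^esup>\<close>, which solves the same equation.
\<close>

unbundle fps_syntax

section \<open>Walks with bounded up-steps\<close>

text \<open>
  The walks of length \<open>n\<close> with first entry less than \<open>j\<close>. Bounding the first entry, rather than
  fixing it, lets the tail of a walk be a walk of the same kind, and lets \<open>j\<close> be increased by one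
  at a time.
\<close>

primrec walks :: "nat \<Rightarrow> nat \<Rightarrow> nat \<Rightarrow> nat list set" where
  "walks m 0 j = {[]}"
| "walks m (Suc n) j = (\<Union>e<j. (#) e ` walks m n (e + m + 1))"

lemma finite_walks [simp]: "finite (walks m n j)"
  by (induction n arbitrary: j) auto

lemma sum_walks_Suc:
  "(\<Sum>w\<in>walks m (Suc n) j. F w) = (\<Sum>e<j. \<Sum>w\<in>walks m n (e + m + 1). F (e # w))"
proof -
  have "(\<Sum>w\<in>walks m (Suc n) j. F w) = (\<Sum>e<j. \<Sum>w\<in>(#) e ` walks m n (e + m + 1). F w)"
    unfolding walks.simps by (rule sum.UNION_disjoint) auto
  also have "\<dots> = (\<Sum>e<j. \<Sum>w\<in>walks m n (e + m + 1). F (e # w))"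
    by (simp only: sum.reindex[OF inj_on_Cons1] o_def)
  finally show ?thesis .
qed

lemma in_walks_iff:
  "w \<in> walks m n j \<longleftrightarrow> length w = n \<and> (\<forall>i<n. w ! i < (if i = 0 then j else w ! (i - 1) + m + 1))"
proof (induction n arbitrary: w j)
  case 0
  then show ?case by auto
next
  case (Suc n)
  show ?case
  proof (cases w)
    case Nil
    then show ?thesis by auto
  next
    case (Cons e v)
    have "w \<in> walks m (Suc n) j \<longleftrightarrow> e < j \<and> v \<in> walks m n (e + m + 1)"
      using Cons by auto
    also have "\<dots> \<longleftrightarrow> length v = n \<and> e < j \<and>
        (\<forall>i<n. v ! i < (if i = 0 then e + m + 1 else v ! (i - 1) + m + 1))"
      using Suc.IH by auto
    also have "(\<forall>i<n. v ! i < (if i = 0 then e + m + 1 else v ! (i - 1) + m + 1)) \<longleftrightarrow>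
        (\<forall>i<n. v ! i < w ! i + m + 1)"
      using Cons by (auto simp: nth_Cons')
    finally show ?thesis
      using Cons by (auto simp: All_less_Suc2)
  qed
qed

lemma walk_nth_Suc_less:
  assumes "w \<in> walks m n j" "Suc i < n"
  shows "w ! Suc i < w ! i + m + 1"
proof -
  have "w ! Suc i < (if Suc i = 0 then j else w ! (Suc i - 1) + m + 1)"
    using assms unfolding in_walks_iff by blast
  then show ?thesis by simp
qed

lemma walk_nth_less:
  assumes "w \<in> walks m n j" "i < n"
  shows "w ! i < j + m * i"
  using assms(2)
proof (induction i)
  case 0
  then show ?case using assms(1) by (auto simp: in_walks_iff)
next
  case (Suc i)
  then have "w ! Suc i < w ! i + m + 1"
    using walk_nth_Suc_less[OF assms(1)] by blast
  with Suc show ?case by simp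
qed

section \<open>Weighted generating functions of walks\<close>

definition walk_fps :: "nat \<Rightarrow> (nat list \<Rightarrow> 'a) \<Rightarrow> nat \<Rightarrow> 'a::comm_ring_1 fps" where
  "walk_fps m F j = Abs_fps (\<lambda>n. \<Sum>w\<in>walks m n j. F w)"

lemma walk_fps_0: "walk_fps m F 0 = fps_const (F [])"
proof (rule fps_ext)
  show "walk_fps m F 0 $ n = fps_const (F []) $ n" for n
    by (cases n) (auto simp: walk_fps_def)
qed

text \<open>
  A walk with first entry less than \<open>j + 1\<close> either has first entry less than \<open>j\<close> (or is empty), or
  starts with \<open>j\<close> and goes on with an entry of at most \<open>j + m\<close>.
\<close>

lemma walk_fps_Suc:
  "walk_fps m F (Suc j) = walk_fps m F j + fps_X * walk_fps m (\<lambda>w. F (j # w)) (j + m + 1)"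
proof (rule fps_ext)
  show "walk_fps m F (Suc j) $ n =
      (walk_fps m F j + fps_X * walk_fps m (\<lambda>w. F (j # w)) (j + m + 1)) $ n" for n
    by (cases n) (simp_all add: walk_fps_def sum_walks_Suc del: walks.simps(2))
qed

lemma walk_fps_scale:
  "walk_fps m (\<lambda>w. c * F w) j = fps_const c * walk_fps m F j"
  by (rule fps_ext) (simp add: walk_fps_def sum_distrib_left)

lemma walk_fps_first_step:
  assumes "\<And>w. F (j # w) = c * G w"
  shows "walk_fps m F (Suc j) = walk_fps m F j + fps_X * fps_const c * walk_fps m G (j + m + 1)"
  by (simp only: walk_fps_Suc assms walk_fps_scale mult.assoc)

lemma walk_fps_cong:
  assumes "\<And>n w. w \<in> walks m n j \<Longrightarrow> F w = G w"
  shows "walk_fps m F j = walk_fps m G j"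
  using assms by (auto simp: walk_fps_def intro!: fps_ext sum.cong)

text \<open>
  The series \<open>a(j)\<close>; its coefficients are the ballot (or Raney) numbers. The scaling \<open>y\<close> of the
  variable is part of the weight, so that no composition of series occurs in the recursions.
\<close>

definition ballot_fps :: "nat \<Rightarrow> 'a \<Rightarrow> nat \<Rightarrow> 'a::comm_ring_1 fps" where
  "ballot_fps m y = walk_fps m (\<lambda>w. y ^ length w)"

lemma ballot_fps_0: "ballot_fps m y 0 = 1"
  by (simp add: ballot_fps_def walk_fps_0)

lemma ballot_fps_Suc:
  "ballot_fps m y (Suc j) = ballot_fps m y j + fps_X * fps_const y * ballot_fps m y (j + m + 1)"
  unfolding ballot_fps_def by (rule walk_fps_first_step) simp

text \<open>
  The coefficient of \<open>x\<^sup>n\<close> in \<open>f (j + 1) - f j\<close> only involves the coefficient of \<open>x\<^bsup>n-1\<^esup>\<close>,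
  albeit at a larger \<open>j\<close>. Hence the outer induction is on \<open>n\<close>, for all \<open>j\<close>, and the inner one on \<open>j\<close>.
\<close>

lemma first_step_recursion_unique:
  fixes f g :: "nat \<Rightarrow> 'a::comm_ring_1 fps"
  assumes "f 0 = g 0"
    and f: "\<And>j. f (Suc j) = f j + fps_X * fps_const y * f (j + m + 1)"
    and g: "\<And>j. g (Suc j) = g j + fps_X * fps_const y * g (j + m + 1)"
  shows "f j = g j"
proof -
  have "f j $ n = g j $ n" for n j
  proof (induction n arbitrary: j)
    case 0
    show ?case
    proof (induction j)
      case (Suc j)
      then show ?case by (subst f, subst g) (simp add: mult.assoc)
    qed (simp add: assms(1))
  next
    case (Suc n)
    note shorter = Suc.IH
    show ?case
    proof (induction j)
      case (Suc j)
      then show ?case using shorter[of "j + m + 1"] by (subst f, subst g) (simp add: mult.assoc)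
    qed (simp add: assms(1))
  qed
  then show ?thesis by (simp add: fps_ext)
qed

lemma first_step_recursion_solution:
  fixes f :: "nat \<Rightarrow> 'a::comm_ring_1 fps"
  assumes "\<And>j. f (Suc j) = f j + fps_X * fps_const y * f (j + m + 1)"
  shows "f j = f 0 * ballot_fps m y j"
proof (rule first_step_recursion_unique[where y = y and m = m, OF _ assms])
  show "f 0 * ballot_fps m y (Suc j) =
      f 0 * ballot_fps m y j + fps_X * fps_const y * (f 0 * ballot_fps m y (j + m + 1))" for j
    by (subst ballot_fps_Suc) (simp only: distrib_left mult_ac)
qed (simp add: ballot_fps_0)

text \<open>
  The shift \<open>\<lambda>j. a(i + j)\<close> solves the recursion of \<open>a\<close> and starts with \<open>a(i)\<close>. Combinatorially, a walk
  that starts below \<open>i + j\<close> is cut at its first entry below \<open>i\<close>.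
\<close>

lemma ballot_fps_add: "ballot_fps m y (i + j) = ballot_fps m y i * ballot_fps m y j"
proof -
  have "ballot_fps m y (i + Suc k) =
      ballot_fps m y (i + k) + fps_X * fps_const y * ballot_fps m y (i + (k + m + 1))" for k
    using ballot_fps_Suc[of m y "i + k"] by (simp only: add_Suc_right add.assoc)
  from first_step_recursion_solution[of "\<lambda>j. ballot_fps m y (i + j)", OF this, of j]
  show ?thesis by simp
qed

lemma ballot_fps_power: "ballot_fps m y j = ballot_fps m y 1 ^ j"
proof (induction j)
  case 0
  show ?case by (simp add: ballot_fps_0)
next
  case (Suc j)
  then show ?case using ballot_fps_add[of m y 1 j] by simp
qed

section \<open>Fuss-Catalan numbers\<close>

lemma card_walks_Suc:
  "card (walks m (Suc n) (Suc j)) = card (walks m (Suc n) j) + card (walks m n (j + m + 1))"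
  using sum_walks_Suc[of "\<lambda>_. 1::nat" m n "Suc j"] sum_walks_Suc[of "\<lambda>_. 1::nat" m n j]
  by (simp del: walks.simps(2))

lemma walks_Suc_0: "walks m (Suc n) 0 = {}"
  by simp

text \<open>
  With \<open>N = (m + 1) n + j\<close>, this is the ballot number \<open>j/N \<cdot> (N choose n)\<close> of walks of length
  \<open>n\<close>, written as \<open>((N - 1) choose n) - m ((N - 1) choose (n - 1))\<close>, for positive \<open>n\<close>. In this form
  the recursion in \<open>j\<close> is Pascal's rule applied to both binomial coefficients.
\<close>

lemma card_walks_ballot:
  "card (walks m (Suc n) j) + m * ((m * Suc n + n + j) choose n) = (m * Suc n + n + j) choose Suc n"
proof (induction n arbitrary: j)
  case 0
  show ?case
    by (induction j) (simp_all add: card_walks_Suc walks_Suc_0 del: walks.simps(2))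
next
  case (Suc n)
  note shorter = Suc.IH
  show ?case
  proof (induction j)
    case 0
    let ?N = "m * Suc (Suc n) + Suc n"
    have "Suc (Suc n) * (?N choose Suc (Suc n)) = (?N - Suc n) * (?N choose Suc n)"
      by (simp only: binomial_absorption binomial_absorb_comp)
    then have "Suc (Suc n) * (?N choose Suc (Suc n)) = Suc (Suc n) * (m * (?N choose Suc n))"
      by (simp only: add_diff_cancel_right' mult_ac)
    then have "?N choose Suc (Suc n) = m * (?N choose Suc n)"
      by (rule mult_left_cancel[THEN iffD1, rotated]) simp
    then show ?case
      by (simp only: walks_Suc_0 card.empty add_0 add_0_right)
  next
    case (Suc j)
    let ?N = "m * Suc (Suc n) + Suc n + j"
    have "m * Suc n + n + (j + m + 1) = ?N" by simp
    then have "card (walks m (Suc n) (j + m + 1)) + m * (?N choose n) = ?N choose Suc n"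
      using shorter[of "j + m + 1"] by (simp only:)
    moreover have "m * Suc (Suc n) + Suc n + Suc j = Suc ?N" by simp
    ultimately show ?case
      using Suc.IH by (simp only: card_walks_Suc binomial_Suc_Suc add_mult_distrib2)
  qed
qed

lemma card_walks_1: "card (walks m n 1) = fuss_catalan m n"
proof (cases n)
  case 0
  then show ?thesis by (simp add: fuss_catalan_def)
next
  case (Suc k)
  define b c where "b = (m * n + n) choose n" and "c = (m * n + n) choose k"
  have "Suc k * ((m * n + n) choose Suc k) = (m * n + n - k) * ((m * n + n) choose k)"
    by (simp only: binomial_absorption binomial_absorb_comp)
  moreover have "m * n + n - k = m * n + 1" using Suc by simp
  ultimately have bc: "n * b = (m * n + 1) * c"
    by (simp only: b_def c_def Suc[symmetric])
  have "m * Suc k + k + 1 = m * n + n" using Suc by simp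
  then have "card (walks m n 1) + m * c = b"
    using card_walks_ballot[of m k 1] by (simp only: b_def c_def Suc[symmetric])
  then have "(m * n + 1) * card (walks m n 1) + m * ((m * n + 1) * c) = (m * n + 1) * b"
    by (metis add_mult_distrib2 mult.left_commute)
  then have "(m * n + 1) * card (walks m n 1) = b"
    unfolding bc[symmetric] by (simp add: algebra_simps)
  then have "b div (m * n + 1) = card (walks m n 1)"
    by (metis Suc_eq_plus1 nat.distinct(1) nonzero_mult_div_cancel_left)
  then show ?thesis
    unfolding fuss_catalan_def b_def by (rule sym)
qed

lemma ballot_fps_1: "ballot_fps m y 1 = Bm m oo (fps_const y * fps_X)"
proof (rule fps_ext)
  fix n
  have "(\<Sum>w\<in>walks m n 1. y ^ length w) = (\<Sum>w\<in>walks m n 1. y ^ n)"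
    by (rule sum.cong) (auto simp: in_walks_iff)
  then show "ballot_fps m y 1 $ n = (Bm m oo (fps_const y * fps_X)) $ n"
    by (simp add: ballot_fps_def walk_fps_def Bm_def fps_compose_linear flip: card_walks_1)
qed

section \<open>Parking functions as walks\<close>

text \<open>
  The distance of each entry below its upper bound. The same map leads from sequences to walks and
  back.
\<close>

definition deficits :: "nat \<Rightarrow> nat list \<Rightarrow> nat list" where
  "deficits m p = map (\<lambda>i. m * i + 1 - p ! i) [0..<length p]"

lemma length_deficits [simp]: "length (deficits m p) = length p"
  by (simp add: deficits_def)

lemma nth_deficits [simp]: "i < length p \<Longrightarrow> deficits m p ! i = m * i + 1 - p ! i"
  by (simp add: deficits_def)

lemma PK_iff:
  "p \<in> PK m n \<longleftrightarrow> length p = n \<and> (\<forall>i. Suc i < n \<longrightarrow> p ! i \<le> p ! Suc i) \<and>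
     (\<forall>i<n. 1 \<le> p ! i \<and> p ! i \<le> m * i + 1)"
proof -
  have "{1..n} = Suc ` {..<n}"
    by (simp add: image_Suc_lessThan)
  then have "(\<forall>i\<in>{1..n}. 1 \<le> p ! (i - 1) \<and> p ! (i - 1) \<le> m * (i - 1) + 1) \<longleftrightarrow>
      (\<forall>i<n. 1 \<le> p ! i \<and> p ! i \<le> m * i + 1)"
    by auto
  then show ?thesis
    unfolding PK_def by (auto simp: sorted_iff_nth_Suc)
qed

lemma deficits_involution:
  assumes "\<And>i. i < length p \<Longrightarrow> p ! i \<le> m * i + 1"
  shows "deficits m (deficits m p) = p"
  using assms by (intro nth_equalityI) auto

lemma bij_deficits: "bij_betw (deficits m) (PK m n) (walks m n 1)"
proof (rule bij_betw_byWitness[where f' = "deficits m"])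
  show "\<forall>p\<in>PK m n. deficits m (deficits m p) = p"
    by (auto simp: PK_iff intro!: deficits_involution)
  have le: "w ! i \<le> m * i" if "w \<in> walks m n 1" "i < n" for w i
    using walk_nth_less[OF that] by simp
  show "\<forall>w\<in>walks m n 1. deficits m (deficits m w) = w"
  proof
    fix w assume w: "w \<in> walks m n 1"
    then have "length w = n" by (simp add: in_walks_iff)
    with le[OF w] show "deficits m (deficits m w) = w"
      by (intro deficits_involution) (simp add: le_SucI)
  qed
  show "deficits m ` PK m n \<subseteq> walks m n 1"
  proof
    fix w assume "w \<in> deficits m ` PK m n"
    then obtain p where p: "p \<in> PK m n" and w: "w = deficits m p" by blast
    have "w ! i < (if i = 0 then 1 else w ! (i - 1) + m + 1)" if i: "i < n" for i
    proof (cases i)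
      case 0
      then show ?thesis using p i by (auto simp: w PK_iff)
    next
      case (Suc k)
      then have "length p = n" "p ! k \<le> p ! Suc k" "p ! k \<le> m * k + 1"
        using p i by (auto simp: PK_iff)
      with Suc i show ?thesis by (auto simp: w)
    qed
    moreover have "length w = n"
      using p by (simp add: w PK_iff)
    ultimately show "w \<in> walks m n 1"
      unfolding in_walks_iff by blast
  qed
  show "deficits m ` walks m n 1 \<subseteq> PK m n"
  proof
    fix p assume "p \<in> deficits m ` walks m n 1"
    then obtain w where w: "w \<in> walks m n 1" and p: "p = deficits m w" by blast
    have len: "length w = n" using w by (simp add: in_walks_iff)
    have "p ! i \<le> p ! Suc i" if i: "Suc i < n" for i
    proof -
      have "w ! Suc i < w ! i + m + 1"
        by (rule walk_nth_Suc_less[OF w i])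
      moreover have "p ! i = m * i + 1 - w ! i" "p ! Suc i = m * i + m + 1 - w ! Suc i"
        using i len by (simp_all add: p)
      ultimately show ?thesis by linarith
    qed
    moreover have "1 \<le> p ! i \<and> p ! i \<le> m * i + 1" if "i < n" for i
      using le[OF w that] that len by (simp add: p)
    moreover have "length p = n"
      by (simp add: p len)
    ultimately show "p \<in> PK m n"
      unfolding PK_iff by blast
  qed
qed

lemma luck_eq_zeros:
  assumes "p \<in> PK m n"
  shows "luck m p = count_list (deficits m p) 0"
proof -
  have "luck m p = card (Suc ` {i. i < n \<and> deficits m p ! i = 0})"
    unfolding luck_def
  proof (rule arg_cong[where f = card], intro set_eqI iffI)
    fix k assume "k \<in> {i \<in> {1..length p}. p ! (i - 1) = m * i - m + 1}"
    then show "k \<in> Suc ` {i. i < n \<and> deficits m p ! i = 0}"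
      using assms by (cases k) (auto simp: PK_iff)
  next
    fix k assume "k \<in> Suc ` {i. i < n \<and> deficits m p ! i = 0}"
    then show "k \<in> {i \<in> {1..length p}. p ! (i - 1) = m * i - m + 1}"
      using assms by (auto simp: PK_iff le_antisym)
  qed
  also have "\<dots> = count_list (deficits m p) 0"
    using assms by (simp add: card_image count_list_eq_length_filter length_filter_conv_card PK_iff
        eq_sym_conv[of 0])
  finally show ?thesis .
qed

text \<open>
  The number of entries that lie on the line through the height \<open>k\<close> with slope \<open>m\<close>. A walk that
  starts at or below this line stays at or below it, and never returns after leaving it.
\<close>

primrec tops :: "nat \<Rightarrow> nat \<Rightarrow> nat list \<Rightarrow> nat" where
  "tops m k [] = 0"
| "tops m k (e # w) = of_bool (e = k) + tops m (k + m) w"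

lemma tops_eq_card: "tops m k w = card {i. i < length w \<and> w ! i = k + m * i}"
proof (induction w arbitrary: k)
  case Nil
  then show ?case by simp
next
  case (Cons e w)
  have "{i. i < length (e # w) \<and> (e # w) ! i = k + m * i} =
      (if e = k then {0} else {}) \<union> Suc ` {i. i < length w \<and> w ! i = k + m + m * i}"
    by (auto simp: nth_Cons' image_iff less_Suc_eq_0_disj split: if_splits)
  then show ?case
    by (simp add: Cons.IH card_Un_disjoint card_image)
qed

lemma tops_eq_0:
  assumes "w \<in> walks m n j" "j \<le> k"
  shows "tops m k w = 0"
proof -
  have "w ! i \<noteq> k + m * i" if "i < length w" for i
    using walk_nth_less[OF assms(1), of i] that assms by (auto simp: in_walks_iff)
  then show ?thesis by (simp add: tops_eq_card)
qed

lemma omega1_eq_tops: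
  assumes "p \<in> PK m n"
  shows "omega1 p = tops m 0 (deficits m p)"
proof -
  have "omega1 p = card (Suc ` {i. i < n \<and> deficits m p ! i = m * i})"
    unfolding omega1_def
  proof (rule arg_cong[where f = card], intro set_eqI iffI)
    fix k assume "k \<in> {i \<in> {1..length p}. p ! (i - 1) = 1}"
    then show "k \<in> Suc ` {i. i < n \<and> deficits m p ! i = m * i}"
      using assms by (cases k) (auto simp: PK_iff)
  next
    fix k assume "k \<in> Suc ` {i. i < n \<and> deficits m p ! i = m * i}"
    then obtain i where i: "i < n" "deficits m p ! i = m * i" "k = Suc i" by blast
    moreover have "length p = n" "1 \<le> p ! i" "p ! i \<le> m * i + 1"
      using assms i by (auto simp: PK_iff)
    ultimately show "k \<in> {i \<in> {1..length p}. p ! (i - 1) = 1}" by auto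
  qed
  also have "\<dots> = tops m 0 (deficits m p)"
    using assms by (simp add: card_image tops_eq_card PK_iff)
  finally show ?thesis .
qed

text \<open>
  At position \<open>k\<close> the lower bound \<open>m (k - 2) + 1 + l \<le> p\<^sub>k\<close> says that the deficit is at most \<open>m - l\<close>.
  The summand 2 accounts for the first position, which is excluded, and for the counting of positions
  from 1; the convention that the value is \<open>n + 1\<close> without a fixed point is the case in which
  \<open>takeWhile\<close> returns the whole list.
\<close>

lemma first_fixed_point_eq_takeWhile:
  assumes p: "p \<in> PK m n" and l: "1 \<le> l" "l \<le> m" and w: "deficits m p = e # w"
  shows "first_fixed_point m l p = length (takeWhile (\<lambda>x. m - l < x) w) + 2"
proof -
  define r where "r = length (takeWhile (\<lambda>x. m - l < x) w)"
  have len: "length p = n" "n = Suc (length w)"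
    using p w length_deficits[of m p] by (auto simp: PK_iff)
  have nth: "w ! i = m * Suc i + 1 - p ! Suc i" and le: "p ! Suc i \<le> m * Suc i + 1"
    if "i < length w" for i
    using nth_deficits[of "Suc i" p m] p that len by (auto simp: w PK_iff)
  have fixed: "i + 2 \<in> fixed_points m l p \<longleftrightarrow> w ! i \<le> m - l" if "i < length w" for i
    using nth[OF that] le[OF that] that len l by (auto simp: fixed_points_def)
  have range: "\<exists>i<length w. k = i + 2" if "k \<in> fixed_points m l p" for k
    using that len by (intro exI[of _ "k - 2"]) (auto simp: fixed_points_def)
  have before: "m - l < w ! i" if "i < r" for i
    using that unfolding r_def by (metis nth_mem set_takeWhileD takeWhile_nth)
  show ?thesis
  proof (cases "r < length w")
    case True
    then have "\<not> m - l < w ! r"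
      unfolding r_def by (rule nth_length_takeWhile)
    then have mem: "r + 2 \<in> fixed_points m l p"
      using fixed[OF True] by simp
    have "Min (fixed_points m l p) = r + 2"
    proof (rule Min_eqI)
      show "finite (fixed_points m l p)" by (simp add: fixed_points_def)
      show "r + 2 \<le> k" if k: "k \<in> fixed_points m l p" for k
        using range[OF k] fixed before k by (metis add_le_mono1 linorder_not_le)
    qed (fact mem)
    with mem show ?thesis by (auto simp: first_fixed_point_def r_def)
  next
    case False
    then have r: "r = length w"
      unfolding r_def using length_takeWhile_le[of _ w] by (meson le_neq_implies_less)
    then have "fixed_points m l p = {}"
      using range fixed before by (metis all_not_in_conv linorder_not_le)
    with r len show ?thesis by (simp add: first_fixed_point_def r_def)
  qed
qed

section \<open>Walks counted by their zeros\<close>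

definition luck_fps :: "nat \<Rightarrow> 'a \<Rightarrow> 'a \<Rightarrow> nat \<Rightarrow> 'a::comm_ring_1 fps" where
  "luck_fps m y q = walk_fps m (\<lambda>w. y ^ length w * q ^ count_list w 0)"

lemma luck_fps_1: "luck_fps m y q 1 = Bmq m q oo (fps_const y * fps_X)"
proof (rule fps_ext)
  fix n
  have "(\<Sum>w\<in>walks m n 1. y ^ length w * q ^ count_list w 0) =
      (\<Sum>p\<in>PK m n. y ^ length (deficits m p) * q ^ count_list (deficits m p) 0)"
    by (rule sum.reindex_bij_betw[OF bij_deficits, symmetric])
  also have "\<dots> = (\<Sum>p\<in>PK m n. y ^ n * q ^ luck m p)"
    by (rule sum.cong) (auto simp: luck_eq_zeros PK_iff)
  finally show "luck_fps m y q 1 $ n = (Bmq m q oo (fps_const y * fps_X)) $ n"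
    by (simp add: luck_fps_def walk_fps_def Bmq_def fps_compose_linear sum_distrib_left)
qed

text \<open>
  Only the entry 0 changes the number of zeros, so the recursion with factor \<open>y\<close> holds from
  \<open>j = 1\<close> on, and the step from \<open>j = 0\<close> to \<open>j = 1\<close> has the factor \<open>y q\<close> instead.
\<close>

lemma luck_fps_functional_equation:
  "luck_fps m y q 1 = 1 + fps_X * fps_const (y * q) * ballot_fps m y m * luck_fps m y q 1"
proof -
  have "luck_fps m y q (Suc (Suc j)) =
      luck_fps m y q (Suc j) + fps_X * fps_const y * luck_fps m y q (Suc (j + m + 1))" for j
    using walk_fps_first_step[of "\<lambda>w. y ^ length w * q ^ count_list w 0" "Suc j" y]
    by (simp add: luck_fps_def mult.assoc)
  from first_step_recursion_solution[of "\<lambda>j. luck_fps m y q (Suc j)", OF this, of m]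
  have later: "luck_fps m y q (Suc m) = luck_fps m y q 1 * ballot_fps m y m"
    by simp
  have "luck_fps m y q (Suc 0) =
      luck_fps m y q 0 + fps_X * fps_const (y * q) * luck_fps m y q (0 + m + 1)"
    unfolding luck_fps_def by (rule walk_fps_first_step) (simp add: mult_ac)
  then have "luck_fps m y q (Suc 0) = 1 + fps_X * fps_const (y * q) * luck_fps m y q (Suc m)"
    by (simp add: luck_fps_def walk_fps_0)
  then show ?thesis
    unfolding later by (simp only: One_nat_def mult_ac)
qed

section \<open>Cutting a walk at its first small entries\<close>

text \<open>
  The series for the walk from position \<open>f\<close> on: \<open>v\<close> counts the entries before the first zero and
  \<open>q\<close> counts zeros.
\<close>

definition zero_fps :: "nat \<Rightarrow> 'a \<Rightarrow> 'a \<Rightarrow> nat \<Rightarrow> 'a::comm_ring_1 fps" where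
  "zero_fps m q v = walk_fps m (\<lambda>w. q ^ count_list w 0 * v ^ length (takeWhile ((<) 0) w))"

text \<open>
  A first entry 0 ends the count of \<open>v\<close>, so at \<open>j = 1\<close> only the zeros matter; each positive first
  entry contributes a factor \<open>v\<close>.
\<close>

lemma zero_fps_Suc: "zero_fps m q v (Suc j) = luck_fps m 1 q 1 * ballot_fps m v j"
proof -
  have base: "zero_fps m q v (Suc 0) = luck_fps m 1 q 1"
    by (simp add: zero_fps_def luck_fps_def walk_fps_Suc[of m _ 0] walk_fps_0)
  have "zero_fps m q v (Suc (Suc j)) =
      zero_fps m q v (Suc j) + fps_X * fps_const v * zero_fps m q v (Suc (j + m + 1))" for j
    using walk_fps_first_step[of "\<lambda>w. q ^ count_list w 0 * v ^ length (takeWhile ((<) 0) w)"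
        "Suc j" v]
    by (simp add: zero_fps_def mult_ac)
  from first_step_recursion_solution[of "\<lambda>j. zero_fps m q v (Suc j)", OF this, of j]
  show ?thesis by (simp add: base)
qed

text \<open>
  The weight of everything but the ones of \<open>p\<close>, for the deficits after the initial zero: \<open>u\<close> counts
  the entries before the first one below \<open>m\<close>.
\<close>

definition low_weight :: "nat \<Rightarrow> 'a \<Rightarrow> 'a \<Rightarrow> 'a \<Rightarrow> nat list \<Rightarrow> 'a::comm_ring_1" where
  "low_weight m q u v w = q ^ count_list w 0 * u ^ length (takeWhile ((\<le>) m) w)
     * v ^ length (takeWhile ((<) 0) w)"

lemma low_weight_Cons:
  "1 \<le> m \<Longrightarrow> m \<le> e \<Longrightarrow> low_weight m q u v (e # w) = (u * v) * low_weight m q u v w"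
  by (auto simp: low_weight_def mult_ac)

text \<open>
  If the first entry is below \<open>m\<close>, then \<open>u\<close> does not occur and the series is the one of
  \<open>zero_fps_Suc\<close>. A first entry of at least \<open>m\<close> is positive as well, so it advances both counts.
\<close>

lemma low_fps:
  assumes "1 \<le> m"
  shows "walk_fps m (low_weight m q u v) (m + j) =
    luck_fps m 1 q 1 * ballot_fps m v (m - 1) * ballot_fps m (u * v) j"
proof -
  have "walk_fps m (low_weight m q u v) m = zero_fps m q v m"
    unfolding zero_fps_def
  proof (rule walk_fps_cong)
    fix n w assume w: "w \<in> walks m n m"
    then have "takeWhile ((\<le>) m) w = []"
      by (cases n) auto
    then show "low_weight m q u v w = q ^ count_list w 0 * v ^ length (takeWhile ((<) 0) w)"
      by (simp add: low_weight_def)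
  qed
  also have "\<dots> = luck_fps m 1 q 1 * ballot_fps m v (m - 1)"
    using zero_fps_Suc[of m q v "m - 1"] assms by simp
  finally have base: "walk_fps m (low_weight m q u v) m = \<dots>" .
  have "walk_fps m (low_weight m q u v) (m + Suc j) = walk_fps m (low_weight m q u v) (m + j)
      + fps_X * fps_const (u * v) * walk_fps m (low_weight m q u v) (m + (j + m + 1))" for j
    using walk_fps_first_step[of "low_weight m q u v" "m + j" "u * v" "low_weight m q u v" m,
        OF low_weight_Cons[OF assms]]
    by (simp add: add.assoc)
  from first_step_recursion_solution[of "\<lambda>j. walk_fps m (low_weight m q u v) (m + j)", OF this, of j]
  show ?thesis by (simp add: base)
qed

definition full_weight :: "nat \<Rightarrow> 'a \<Rightarrow> 'a \<Rightarrow> 'a \<Rightarrow> 'a \<Rightarrow> nat \<Rightarrow> nat list \<Rightarrow> 'a::comm_ring_1" where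
  "full_weight m q t u v k w = t ^ tops m k w * low_weight m q u v w"

lemma top_recursion_unique:
  fixes f g h :: "nat \<Rightarrow> 'a::comm_ring_1 fps"
  assumes f: "\<And>j. f j = h j + fps_X * fps_const y * f (j + m)"
    and g: "\<And>j. g j = h j + fps_X * fps_const y * g (j + m)"
  shows "f j = g j"
proof -
  have "f j $ n = g j $ n" for n j
  proof (induction n arbitrary: j)
    case 0
    show ?case by (subst f, subst g) (simp add: mult.assoc)
  next
    case (Suc n)
    show ?case by (subst f, subst g) (simp add: mult.assoc Suc)
  qed
  then show ?thesis by (simp add: fps_ext)
qed

text \<open>
  The walks are counted along with the entries on the line through \<open>m + j\<close>, the largest permitted
  first entry. If the first entry is smaller, no entry is on the line and the weight is \<open>low_weight\<close>;
  otherwise the line passes through \<open>m + j + m\<close> at the next entry, which is again the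
  largest one permitted. So the series \<open>X(j)\<close> satisfies \<open>X(j) = C a(j) + u v t x X(j + m)\<close>, with \<open>C a(j)\<close>
  from \<open>low_fps\<close>. As \<open>a(j + m) = a(j) a(m)\<close>, the solution is \<open>C a(j)\<close> times the solution of
  \<open>Z = 1 + u v t x a(m) Z\<close>, which is the series of walks counted by zeros: this is where
  ones are traded for lucky positions.
\<close>

lemma full_fps:
  fixes q t u v :: "'a::comm_ring_1"
  assumes "1 \<le> m"
  shows "walk_fps m (full_weight m q t u v (m + j)) (m + j + 1) =
    luck_fps m 1 q 1 * ballot_fps m v (m - 1) * ballot_fps m (u * v) j * luck_fps m (u * v) t 1"
proof (rule top_recursion_unique[where m = m and y = "u * v * t" and j = j
      and f = "\<lambda>j. walk_fps m (full_weight m q t u v (m + j)) (m + j + 1)"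
      and g = "\<lambda>j. luck_fps m 1 q 1 * ballot_fps m v (m - 1) * ballot_fps m (u * v) j
        * luck_fps m (u * v) t 1"
      and h = "\<lambda>j. luck_fps m 1 q 1 * ballot_fps m v (m - 1) * ballot_fps m (u * v) j"])
  fix j
  have below: "walk_fps m (full_weight m q t u v (m + j)) (m + j) =
      walk_fps m (low_weight m q u v) (m + j)"
    by (rule walk_fps_cong) (simp add: full_weight_def tops_eq_0)
  have step: "full_weight m q t u v (m + j) ((m + j) # w) =
      (u * v * t) * full_weight m q t u v (m + (j + m)) w" for w
    using assms by (simp add: full_weight_def low_weight_Cons mult_ac add_ac)
  show "walk_fps m (full_weight m q t u v (m + j)) (m + j + 1) =
      luck_fps m 1 q 1 * ballot_fps m v (m - 1) * ballot_fps m (u * v) j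
      + fps_X * fps_const (u * v * t) *
        walk_fps m (full_weight m q t u v (m + (j + m))) (m + (j + m) + 1)"
    using walk_fps_first_step[where m = m and j = "m + j" and c = "u * v * t"
        and F = "full_weight m q t u v (m + j)" and G = "full_weight m q t u v (m + (j + m))", OF step]
    unfolding below low_fps[OF assms]
    by (simp only: Suc_eq_plus1 add.assoc)
next
  fix j
  let ?C = "luck_fps m 1 q 1 * ballot_fps m v (m - 1)"
  let ?L = "luck_fps m (u * v) t 1"
  have "?C * ballot_fps m (u * v) j * ?L = ?C * ballot_fps m (u * v) j *
      (1 + fps_X * fps_const (u * v * t) * ballot_fps m (u * v) m * ?L)"
    using luck_fps_functional_equation[of m "u * v" t] by simp
  also have "\<dots> = ?C * ballot_fps m (u * v) j
      + fps_X * fps_const (u * v * t) * (?C * ballot_fps m (u * v) (j + m) * ?L)"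
    unfolding ballot_fps_add by (simp only: algebra_simps mult_1)
  finally show "?C * ballot_fps m (u * v) j * ?L = ?C * ballot_fps m (u * v) j
      + fps_X * fps_const (u * v * t) * (?C * ballot_fps m (u * v) (j + m) * ?L)" .
qed

text \<open>
  The first deficit is 0. It is lucky and a one, which gives the factor \<open>q t\<close>, and both fixed points are
  at least 2, which gives \<open>(u v)\<^sup>2\<close>. Its successor is at most \<open>m\<close>.
\<close>

lemma Gamma_fps_eq_walk_fps:
  fixes q t u v :: "'a::comm_ring_1"
  assumes "1 \<le> m"
  shows "Gamma_fps m q t u v =
    1 + fps_X * fps_const (q * t * (u * v) ^ 2) * walk_fps m (full_weight m q t u v m) (m + 1)"
proof (rule fps_ext)
  fix n
  show "Gamma_fps m q t u v $ n = (1 + fps_X * fps_const (q * t * (u * v) ^ 2)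
      * walk_fps m (full_weight m q t u v m) (m + 1)) $ n"
  proof (cases n)
    case 0
    then show ?thesis by (simp add: Gamma_fps_def gamma_coeff_def mult.assoc)
  next
    case (Suc k)
    define F where "F w = q ^ count_list w 0 * t ^ tops m 0 w
        * u ^ (length (takeWhile (\<lambda>x. m - 1 < x) (tl w)) + 2)
        * v ^ (length (takeWhile (\<lambda>x. m - m < x) (tl w)) + 2)" for w
    have "Gamma_fps m q t u v $ n = (\<Sum>p\<in>PK m n. F (deficits m p))"
      unfolding Gamma_fps_def gamma_coeff_def fps_nth_Abs_fps
    proof (subst if_not_P, use Suc in simp, rule sum.cong[OF refl])
      fix p assume p: "p \<in> PK m n"
      then have "length (deficits m p) = Suc k" using Suc by (simp add: PK_iff)
      then obtain e w where w: "deficits m p = e # w" by (meson length_Suc_conv)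
      show "q ^ luck m p * t ^ omega1 p * u ^ first_fixed_point m 1 p
          * v ^ first_fixed_point m m p = F (deficits m p)"
        using first_fixed_point_eq_takeWhile[OF p _ _ w, of 1]
          first_fixed_point_eq_takeWhile[OF p _ _ w, of m] assms
        by (simp only: F_def luck_eq_zeros[OF p] omega1_eq_tops[OF p] w list.sel order_refl)
    qed
    also have "\<dots> = (\<Sum>w\<in>walks m n 1. F w)"
      by (rule sum.reindex_bij_betw[OF bij_deficits])
    also have "\<dots> = (\<Sum>w\<in>walks m k (m + 1). F (0 # w))"
      unfolding Suc sum_walks_Suc by simp
    also have "\<dots> = (\<Sum>w\<in>walks m k (m + 1). q * t * (u * v) ^ 2 * full_weight m q t u v m w)"
    proof (rule sum.cong[OF refl])
      fix w
      have "(\<lambda>x. m - 1 < x) = (\<le>) m" using assms by auto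
      then show "F (0 # w) = q * t * (u * v) ^ 2 * full_weight m q t u v m w"
        by (simp add: F_def full_weight_def low_weight_def power_add power2_eq_square mult_ac)
    qed
    finally show ?thesis
      using Suc by (simp add: walk_fps_def sum_distrib_left mult.assoc)
  qed
qed

theorem theorem6p1:
  fixes m :: nat and q t u v :: "'a::comm_ring_1"
  assumes "m \<ge> 1"
  shows "Gamma_fps m q t u v =
    1 + fps_X * fps_const (q * t * (u * v) ^ 2)
      * (Bm m oo (fps_const v * fps_X)) ^ (m - 1)
      * Bmq m q
      * (Bmq m t oo (fps_const (u * v) * fps_X))"
proof -
  have "luck_fps m 1 q 1 = Bmq m q"
    by (simp only: luck_fps_1 fps_compose_linear power_one mult_1 fps_nth_inverse)
  moreover have "ballot_fps m v (m - 1) = (Bm m oo (fps_const v * fps_X)) ^ (m - 1)"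
    by (simp only: ballot_fps_power[of m v "m - 1"] ballot_fps_1)
  ultimately have "walk_fps m (full_weight m q t u v m) (m + 1) =
      Bmq m q * (Bm m oo (fps_const v * fps_X)) ^ (m - 1) * (Bmq m t oo (fps_const (u * v) * fps_X))"
    using full_fps[OF assms, of q t u v 0] by (simp add: ballot_fps_0 flip: luck_fps_1)
  then show ?thesis
    unfolding Gamma_fps_eq_walk_fps[OF assms] by (simp only: mult_ac)
qed

end
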